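(* For all positive integers $d,k,n$ there exists $r$ such that $\mathrm{ENSH}^d_k(\underbrace{n\cdots n}_{r})$ does not hold, where $n\cdots n$ is the constant sequence of length $r$ with value $n$.
   Context: Identify $d$ with $\{0,\dots,d-1\}$ and $k$ with $\{0,\dots,k-1\}$; $d^n$ is the set of words of length $n$ over $d$. A variable word over $d$ is a sequence $v$ with entries in $\{0,\dots,d-1\}\cup\{x_0,x_1,\dots\}$, the $x_m$ being variables; the first occurrence of a variable $x_m$ occurring in $v$ is $\min\{t:v(t)=x_m\}$. An $n$-variable word is a variable word in which exactly $n$ variables occur, with the convention that the first occurrences are increasing in the variable index. For a finite $n$-variable word $v$ and $\vec a\in d^n$, $v(\vec a)$ is the word obtained by replacing the $j$-th variable occurring in $v$ (in order of index) by $\vec a(j)$, for all $j<n$. Let $n_0,\dots,n_{r-1}$ be positive integers, $N=n_0+\cdots+n_{r-1}$, and $N_s=\{n_0+\cdots+n_{s-1},\dots,n_0+\cdots+n_s-1\}$ for $s\le r-1$. For $f:d^N\to k$, the sequence $n_0\cdots n_{r-1}$ is sectionally-homogeneous for $f$ if there exist $s\le r-1$ and an $n_s$-variable word $v$ over $d$ of length $N$ such that the set of first occurrences of the variables occurring in $v$ is exactly $N_s$ and $f$ is constant on $\{v(\vec a):\vec a\in d^{n_s}\}$. $\mathrm{ENSH}^d_k(n_0\cdots n_{r-1})$ holds if there exists $f:d^N\to k$ such that $n_0\cdots n_{r-1}$ is not sectionally-homogeneous for $f$. *)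

theory Defs
  imports Main
begin

definition words :: "nat \<Rightarrow> nat \<Rightarrow> nat list set" where
  "words d n = {w. set w \<subseteq> {..<d} \<and> length w = n}"

datatype letter = Const nat | Var nat

definition variable_word :: "nat \<Rightarrow> letter list \<Rightarrow> bool" where
  "variable_word d v \<longleftrightarrow> set v \<subseteq> Const ` {..<d} \<union> range Var"

definition vars :: "letter list \<Rightarrow> nat set" where
  "vars v = {m. Var m \<in> set v}"

text \<open>Meaningful only for \<open>m \<in> vars v\<close>.\<close>
definition first_occ :: "letter list \<Rightarrow> nat \<Rightarrow> nat" where
  "first_occ v m = (LEAST t. t < length v \<and> v ! t = Var m)"

definition n_variable_word :: "nat \<Rightarrow> nat \<Rightarrow> letter list \<Rightarrow> bool" where
  "n_variable_word d n v \<longleftrightarrow>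
     variable_word d v \<and> card (vars v) = n \<and> strict_mono_on (vars v) (first_occ v)"

text \<open>The variables of \<open>v\<close> need not be \<open>x\<^sub>0, \<dots>, x\<^sub>n\<^sub>-\<^sub>1\<close>: the \<open>j\<close>-th variable occurring
  in \<open>v\<close> is the \<open>j\<close>-th element (from 0) of \<open>vars v\<close> in increasing order.\<close>
definition substitute :: "letter list \<Rightarrow> nat list \<Rightarrow> nat list" where
  "substitute v a =
     map (\<lambda>l. case l of Const c \<Rightarrow> c | Var m \<Rightarrow> a ! card {i \<in> vars v. i < m}) v"

definition block :: "nat list \<Rightarrow> nat \<Rightarrow> nat set" where
  "block ns s = {sum_list (take s ns) ..< sum_list (take (Suc s) ns)}"

definition sectionally_homogeneous :: "nat \<Rightarrow> nat list \<Rightarrow> (nat list \<Rightarrow> nat) \<Rightarrow> bool" where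
  "sectionally_homogeneous d ns f \<longleftrightarrow>
     (\<exists>s < length ns. \<exists>v. n_variable_word d (ns ! s) v \<and> length v = sum_list ns \<and>
        first_occ v ` vars v = block ns s \<and>
        (\<exists>c. \<forall>a \<in> words d (ns ! s). f (substitute v a) = c))"

text \<open>A colouring \<open>d\<^sup>N \<rightarrow> k\<close> is a total function on lists of which only the values on
  \<open>words d N\<close> matter.\<close>
definition ENSH :: "nat \<Rightarrow> nat \<Rightarrow> nat list \<Rightarrow> bool" where
  "ENSH d k ns \<longleftrightarrow>
     (\<exists>f. f ` words d (sum_list ns) \<subseteq> {..<k} \<and> \<not> sectionally_homogeneous d ns f)"

end

theory Submission
  imports Defs "HOL-Library.FuncSet"
begin

text \<open>A word of length \<open>r n\<close> over \<open>d\<close> is a word of length \<open>r\<close> over the alphabet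
  \<open>d\<^sup>n\<close>. A combinatorial line over that alphabet becomes, on replacing its wildcard by
  \<open>x\<^sub>0 \<cdots> x\<^sub>n\<^sub>-\<^sub>1\<close>, an \<open>n\<close>-variable word whose variables first occur exactly in the
  block of the first wildcard. So the claim is the Hales-Jewett theorem for \<open>d\<^sup>n\<close>, which is
  proved by colour focusing.\<close>

section \<open>Words, combinatorial lines and the Hales-Jewett property\<close>

definition words_over :: "'a set \<Rightarrow> nat \<Rightarrow> 'a list set" where
  "words_over A N = {w. set w \<subseteq> A \<and> length w = N}"

text \<open>The wildcard of a combinatorial line is \<^const>\<open>None\<close>.\<close>

definition lines :: "'a set \<Rightarrow> nat \<Rightarrow> 'a option list set" where
  "lines A N = {w. set w \<subseteq> insert None (Some ` A) \<and> None \<in> set w \<and> length w = N}"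

definition point :: "'a option list \<Rightarrow> 'a \<Rightarrow> 'a list" where
  "point w a = map (case_option a id) w"

definition has_mono_line :: "'a set \<Rightarrow> nat \<Rightarrow> ('a list \<Rightarrow> 'c) \<Rightarrow> bool" where
  "has_mono_line A N f \<longleftrightarrow> (\<exists>w \<in> lines A N. \<exists>c. \<forall>a \<in> A. f (point w a) = c)"

text \<open>The number \<open>k\<close> of colours is quantified inside, so that the induction on
  the alphabet may use many more colours for the smaller alphabet.\<close>

definition hales_jewett :: "'a set \<Rightarrow> bool" where
  "hales_jewett A \<longleftrightarrow>
     (\<forall>k::nat. \<exists>N. \<forall>f. f ` words_over A N \<subseteq> {..<k} \<longrightarrow> has_mono_line A N f)"

lemma point_append [simp]: "point (v @ w) a = point v a @ point w a"
  by (simp add: point_def)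

lemma point_map_Some [simp]: "point (map Some u) a = u"
  by (simp add: point_def comp_def)

lemma point_in_words_over:
  assumes "w \<in> lines A N" "a \<in> A"
  shows "point w a \<in> words_over A N"
  using assms by (fastforce simp: lines_def words_over_def point_def)

lemma words_over_append:
  assumes "u \<in> words_over A M" "v \<in> words_over A N"
  shows "u @ v \<in> words_over A (M + N)"
  using assms by (auto simp: words_over_def)

lemma words_over_mono: "A \<subseteq> B \<Longrightarrow> words_over A N \<subseteq> words_over B N"
  by (auto simp: words_over_def)

lemma lines_mono: "A \<subseteq> B \<Longrightarrow> lines A N \<subseteq> lines B N"
  by (auto simp: lines_def)

lemma lines_append:
  assumes "v \<in> lines A M" "w \<in> lines A N"
  shows "v @ w \<in> lines A (M + N)"
  using assms by (auto simp: lines_def)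

lemma lines_append_word:
  assumes "v \<in> lines A M" "u \<in> words_over A N"
  shows "v @ map Some u \<in> lines A (M + N)"
  using assms by (auto simp: lines_def words_over_def)

lemma word_append_lines:
  assumes "u \<in> words_over A M" "v \<in> lines A N"
  shows "map Some u @ v \<in> lines A (M + N)"
  using assms by (auto simp: lines_def words_over_def)

lemma finite_words_over: "finite A \<Longrightarrow> finite (words_over A N)"
  unfolding words_over_def by (rule finite_lists_length_eq)

text \<open>Numbering the colours by \<open>h\<close> loses nothing, because \<open>h\<close> is
  injective on \<open>K\<close>. This admits colours that are themselves functions.\<close>

lemma hales_jewett_finite_colours:
  assumes "hales_jewett A" "finite K"
  obtains N where "\<And>f. f ` words_over A N \<subseteq> K \<Longrightarrow> has_mono_line A N f"
proof -
  obtain h where h: "bij_betw h K {0..<card K}"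
    using ex_bij_betw_finite_nat[OF assms(2)] by blast
  obtain N where N: "\<And>f. f ` words_over A N \<subseteq> {..<card K} \<Longrightarrow> has_mono_line A N f"
    using assms(1) unfolding hales_jewett_def by blast
  have "has_mono_line A N f" if f: "f ` words_over A N \<subseteq> K" for f
  proof -
    have "(h \<circ> f) ` words_over A N \<subseteq> {..<card K}"
      using f bij_betwE[OF h] by auto
    then obtain w c where w: "w \<in> lines A N" "\<And>a. a \<in> A \<Longrightarrow> h (f (point w a)) = c"
      using N[of "h \<circ> f"] by (auto simp: has_mono_line_def)
    have "f (point w a) = f (point w b)" if "a \<in> A" "b \<in> A" for a b
    proof (rule inj_onD[of h K])
      show "inj_on h K" using h by (simp add: bij_betw_def)
      show "h (f (point w a)) = h (f (point w b))" using w that by simp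
    qed (use f that point_in_words_over[OF w(1)] in auto)
    then show ?thesis
      using w(1) unfolding has_mono_line_def by metis
  qed
  then show thesis using that by blast
qed

text \<open>Colour a prefix \<open>u\<close> by the whole function sending \<open>v\<close> to
  \<open>f (u @ v)\<close>. Only finitely many such functions arise, so the Hales-Jewett property of
  \<open>A\<close> gives a line that is monochromatic for this colouring.\<close>

lemma uniform_line:
  fixes k N :: nat
  assumes "hales_jewett A" "finite B"
  obtains M where
    "\<And>f. (\<And>u v. u \<in> words_over A M \<Longrightarrow> v \<in> words_over B N \<Longrightarrow> f (u @ v) < k) \<Longrightarrow>
       \<exists>w \<in> lines A M. \<forall>a \<in> A. \<forall>b \<in> A. \<forall>v \<in> words_over B N.
         f (point w a @ v) = f (point w b @ v)"
proof -
  let ?K = "PiE (words_over B N) (\<lambda>_. {..<k})"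
  have "finite ?K"
    using assms(2) by (intro finite_PiE) (auto simp: finite_words_over)
  then obtain M where M: "\<And>g. g ` words_over A M \<subseteq> ?K \<Longrightarrow> has_mono_line A M g"
    using hales_jewett_finite_colours[OF assms(1)] by metis
  have "\<exists>w \<in> lines A M. \<forall>a \<in> A. \<forall>b \<in> A. \<forall>v \<in> words_over B N.
         f (point w a @ v) = f (point w b @ v)"
    if f: "\<And>u v. u \<in> words_over A M \<Longrightarrow> v \<in> words_over B N \<Longrightarrow> f (u @ v) < k" for f
  proof -
    \<comment> \<open>\<open>restrict\<close> fixes the values outside
      \<open>words_over B N\<close>, which puts \<open>g u\<close> into the finite set
      \<open>?K\<close>.\<close>
    define g where "g u = restrict (\<lambda>v. f (u @ v)) (words_over B N)" for u
    have "g ` words_over A M \<subseteq> ?K"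
      using f by (auto simp: g_def)
    from M[OF this] obtain w c where w: "w \<in> lines A M" "\<And>a. a \<in> A \<Longrightarrow> g (point w a) = c"
      by (auto simp: has_mono_line_def)
    have "f (point w a @ v) = c v" if "a \<in> A" "v \<in> words_over B N" for a v
      using w(2)[OF that(1)] that(2) by (auto simp: g_def)
    then show ?thesis using w(1) by (intro bexI[of _ w]) auto
  qed
  then show thesis using that by blast
qed

section \<open>Colour focusing\<close>

text \<open>Lines that are monochromatic on \<open>A\<close>, in distinct colours, and that all meet in the
  same point when the wildcard takes the new letter \<open>z\<close>.\<close>

definition colour_focused ::
  "'a set \<Rightarrow> 'a \<Rightarrow> nat \<Rightarrow> ('a list \<Rightarrow> 'c) \<Rightarrow> 'c set \<Rightarrow> 'a list \<Rightarrow> bool" where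
  "colour_focused A z N f C p \<longleftrightarrow> p \<in> words_over (insert z A) N \<and>
     (\<forall>c \<in> C. \<exists>w \<in> lines (insert z A) N. point w z = p \<and> (\<forall>a \<in> A. f (point w a) = c))"

text \<open>The line with colour \<open>f p\<close> on \<open>A\<close> reaches \<open>p\<close>
  itself at the letter \<open>z\<close>, so it keeps its colour there.\<close>

lemma colour_focused_mono_line:
  assumes "colour_focused A z N f C p" "f p \<in> C"
  shows "has_mono_line (insert z A) N f"
  using assms unfolding colour_focused_def has_mono_line_def by (metis insert_iff)

lemma has_mono_line_prefix:
  assumes "u \<in> words_over A M" "has_mono_line A N (\<lambda>v. f (u @ v))"
  shows "has_mono_line A (M + N) f"
proof -
  obtain w c where w: "w \<in> lines A N" "\<And>a. a \<in> A \<Longrightarrow> f (u @ point w a) = c"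
    using assms(2) by (auto simp: has_mono_line_def)
  then show ?thesis
    unfolding has_mono_line_def
    by (intro bexI[OF _ word_append_lines[OF assms(1) w(1)]] exI[of _ c]) simp
qed

text \<open>Over \<open>A\<close> the prefix \<open>point w a\<close> may be exchanged for
  \<open>point w b\<close>. Hence an old line with \<open>w\<close> prepended, both wildcards moving
  together, keeps its colour, and \<open>w\<close> followed by the fixed word \<open>p\<close> is a
  line in the colour of the old focus. At \<open>z\<close> all of them end in
  \<open>point w z @ p\<close>.\<close>

lemma colour_focused_extend:
  assumes foc: "colour_focused A z N (\<lambda>v. f (point w b @ v)) C p"
    and w: "w \<in> lines A M" and b: "b \<in> A"
    and eq: "\<And>a v. a \<in> A \<Longrightarrow> v \<in> words_over (insert z A) N \<Longrightarrow>
               f (point w a @ v) = f (point w b @ v)"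
  shows "colour_focused A z (M + N) f (insert (f (point w b @ p)) C) (point w z @ p)"
proof -
  let ?B = "insert z A"
  have w': "w \<in> lines ?B M"
    using w lines_mono[of A ?B] by blast
  have p: "p \<in> words_over ?B N"
    using foc by (simp add: colour_focused_def)
  have "\<exists>v \<in> lines ?B (M + N). point v z = point w z @ p \<and> (\<forall>a \<in> A. f (point v a) = c)"
    if "c \<in> insert (f (point w b @ p)) C" for c
  proof (cases "c = f (point w b @ p)")
    case True
    then show ?thesis
      using eq p by (intro bexI[OF _ lines_append_word[OF w' p]]) auto
  next
    case False
    with that have "c \<in> C" by simp
    then obtain v where v: "v \<in> lines ?B N" "point v z = p"
        "\<And>a. a \<in> A \<Longrightarrow> f (point w b @ point v a) = c"
      using foc unfolding colour_focused_def by blast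
    then show ?thesis
      using eq point_in_words_over[OF v(1)]
      by (intro bexI[OF _ lines_append[OF w' v(1)]]) auto
  qed
  then show ?thesis
    using words_over_append[OF point_in_words_over[OF w', of z] p]
    by (simp add: colour_focused_def)
qed

text \<open>As long as no monochromatic line appears, each step of the induction on \<open>m\<close>
  adds one more colour to the focused family.\<close>

lemma colour_focusing:
  fixes k m :: nat
  assumes "hales_jewett A" "finite A" "A \<noteq> {}"
  shows "\<exists>N. \<forall>f. f ` words_over (insert z A) N \<subseteq> {..<k} \<longrightarrow>
           has_mono_line (insert z A) N f \<or>
           (\<exists>C p. C \<subseteq> {..<k} \<and> card C = m \<and> colour_focused A z N f C p)"
proof (induction m)
  case 0
  have "colour_focused A z 0 f {} []" for f :: "'a list \<Rightarrow> nat"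
    by (simp add: colour_focused_def words_over_def)
  then show ?case by (metis card.empty empty_subsetI)
next
  case (Suc m)
  let ?B = "insert z A"
  obtain N where N: "\<And>f. f ` words_over ?B N \<subseteq> {..<k} \<Longrightarrow>
           has_mono_line ?B N f \<or>
           (\<exists>C p. C \<subseteq> {..<k} \<and> card C = m \<and> colour_focused A z N f C p)"
    using Suc.IH by blast
  \<comment> \<open>\<open>M\<close> is chosen after \<open>N\<close>: it depends on how many
    colourings of the words of length \<open>N\<close> there are.\<close>
  obtain M where M: "\<And>f. (\<And>u v. u \<in> words_over A M \<Longrightarrow> v \<in> words_over ?B N \<Longrightarrow> f (u @ v) < k) \<Longrightarrow>
       \<exists>w \<in> lines A M. \<forall>a \<in> A. \<forall>b \<in> A. \<forall>v \<in> words_over ?B N.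
         f (point w a @ v) = f (point w b @ v)"
    using uniform_line[OF assms(1) finite.insertI[OF assms(2)]] by metis
  obtain b where b: "b \<in> A" using assms(3) by blast
  have "has_mono_line ?B (M + N) f \<or>
      (\<exists>C p. C \<subseteq> {..<k} \<and> card C = Suc m \<and> colour_focused A z (M + N) f C p)"
    if f: "f ` words_over ?B (M + N) \<subseteq> {..<k}" for f
  proof -
    have fk: "f (u @ v) < k" if "u \<in> words_over ?B M" "v \<in> words_over ?B N" for u v
      using f words_over_append[OF that] by auto
    have "f (u @ v) < k" if "u \<in> words_over A M" "v \<in> words_over ?B N" for u v
      using fk that words_over_mono[of A ?B M] by blast
    then obtain w where w: "w \<in> lines A M"
        and eq: "\<And>a v. a \<in> A \<Longrightarrow> v \<in> words_over ?B N \<Longrightarrow> f (point w a @ v) = f (point w b @ v)"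
      using M[of f] b by blast
    let ?g = "\<lambda>v. f (point w b @ v)"
    have wb: "point w b \<in> words_over ?B M"
      using point_in_words_over[OF w b] words_over_mono[of A ?B M] by blast
    have g: "?g ` words_over ?B N \<subseteq> {..<k}"
      using fk[OF wb] by auto
    show ?thesis
    proof (cases "has_mono_line ?B N ?g")
      case True
      then show ?thesis using has_mono_line_prefix[OF wb] by blast
    next
      case False
      then obtain C p where C: "C \<subseteq> {..<k}" "card C = m" and foc: "colour_focused A z N ?g C p"
        using N[OF g] by blast
      \<comment> \<open>A focus with a colour in \<open>C\<close> would complete a monochromatic
        line. So its colour is new, and \<open>insert (?g p) C\<close> has \<open>Suc m\<close>
        elements.\<close>
      have "?g p \<notin> C"
        using colour_focused_mono_line[OF foc] False by blast
      moreover have "finite C" using C(1) finite_subset by blast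
      moreover have "?g p < k"
        using foc g by (auto simp: colour_focused_def)
      ultimately show ?thesis
        using colour_focused_extend[OF foc w b eq] C
        by (intro disjI2 exI[of _ "insert (?g p) C"] exI[of _ "point w z @ p"]) simp
    qed
  qed
  then show ?case by blast
qed

text \<open>Induction on the alphabet. Over one letter a line has a single point. For a new letter,
  focusing on \<open>Suc k\<close> distinct colours is impossible when only \<open>k\<close> exist,
  so a monochromatic line must occur.\<close>

theorem hales_jewett:
  assumes "finite A" "A \<noteq> {}"
  shows "hales_jewett A"
  using assms
proof (induction A rule: finite_ne_induct)
  case (singleton x)
  have "has_mono_line {x} 1 f" for f :: "'a list \<Rightarrow> nat"
    unfolding has_mono_line_def by (rule bexI[of _ "[None]"]) (auto simp: lines_def)
  then show ?case unfolding hales_jewett_def by blast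
next
  case (insert z A)
  show ?case
    unfolding hales_jewett_def
  proof
    fix k :: nat
    obtain N where N: "\<And>f. f ` words_over (insert z A) N \<subseteq> {..<k} \<Longrightarrow>
        has_mono_line (insert z A) N f \<or>
        (\<exists>C p. C \<subseteq> {..<k} \<and> card C = Suc k \<and> colour_focused A z N f C p)"
      using colour_focusing[OF insert.IH insert.hyps(1,2)] by metis
    have "card C \<noteq> Suc k" if "C \<subseteq> {..<k}" for C
      using card_mono[OF _ that] by auto
    then show "\<exists>N. \<forall>f. f ` words_over (insert z A) N \<subseteq> {..<k} \<longrightarrow> has_mono_line (insert z A) N f"
      using N by meson
  qed
qed

section \<open>From combinatorial lines to variable words\<close>

definition expand :: "nat \<Rightarrow> nat list option list \<Rightarrow> letter list" where
  "expand n w = concat (map (case_option (map Var [0..<n]) (map Const)) w)"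

lemma length_concat_uniform:
  "(\<And>u. u \<in> set us \<Longrightarrow> length u = n) \<Longrightarrow> length (concat us) = length us * n"
  by (induction us) auto

text \<open>The cut is at the first wildcard; \<open>length us\<close> will be the index of the
  block where the variables first occur.\<close>

lemma split_line:
  assumes "w \<in> lines A r"
  obtains us w' where "w = map Some us @ None # w'" "us \<in> words_over A (length us)"
    "set w' \<subseteq> insert None (Some ` A)" "length us < r"
proof -
  obtain xs ys where w: "w = xs @ None # ys" "None \<notin> set xs"
    using assms split_list_first[of None w] by (auto simp: lines_def)
  have "map Some (map the xs) = xs"
    using w(2) by (induction xs) auto
  moreover have "set xs \<subseteq> Some ` A"
    using assms w by (auto simp: lines_def)
  ultimately show thesis
    using assms w that[of "map the xs" ys]
    by (force simp: lines_def words_over_def)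
qed

text \<open>All wildcards expand to the same variables, so substituting \<open>a\<close> turns each
  of them into \<open>a\<close> and yields the concatenated point of the line at
  \<open>a\<close>.\<close>

lemma sectionally_homogeneous_if_mono_line:
  assumes mono: "has_mono_line (words d n) r (\<lambda>u. f (concat u))"
  shows "sectionally_homogeneous d (replicate r n) f"
proof -
  obtain w c where w: "w \<in> lines (words d n) r"
      and c: "\<And>a. a \<in> words d n \<Longrightarrow> f (concat (point w a)) = c"
    using mono by (auto simp: has_mono_line_def)
  obtain us w' where split: "w = map Some us @ None # w'"
      and us: "us \<in> words_over (words d n) (length us)"
      and w': "set w' \<subseteq> insert None (Some ` words d n)" and s: "length us < r"
    using split_line[OF w] .
  define v where "v = expand n w"
  have v: "v = map Const (concat us) @ map Var [0..<n] @ expand n w'"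
    by (simp add: v_def expand_def split map_concat comp_def)
  have len_us: "length (concat us) = length us * n"
    using us by (intro length_concat_uniform) (auto simp: words_over_def words_def)
  have len_v: "length v = r * n"
  proof -
    have "length v = length w * n"
      unfolding v_def expand_def
      using w length_concat_uniform[of "map (case_option (map Var [0..<n]) (map Const)) w" n]
      by (fastforce simp: lines_def words_def)
    then show ?thesis using w by (simp add: lines_def)
  qed
  have letters: "set v \<subseteq> Const ` {..<d} \<union> Var ` {..<n}"
    using w by (fastforce simp: v_def expand_def lines_def words_def)
  have vars: "vars v = {..<n}"
    \<comment> \<open>The second \<open>auto\<close> shows that every variable below
      \<open>n\<close> occurs, namely in the expansion of the first wildcard.\<close>
    using letters by (auto simp: vars_def) (auto simp: v)
  have occ: "first_occ v m = length us * n + m" if "m < n" for m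
    unfolding first_occ_def
  proof (rule Least_equality)
    show "length us * n + m < length v \<and> v ! (length us * n + m) = Var m"
      using that by (simp add: v nth_append len_us)
  next
    fix t assume t: "t < length v \<and> v ! t = Var m"
    show "length us * n + m \<le> t"
    proof (rule ccontr)
      \<comment> \<open>An earlier position holds a constant from \<open>us\<close> or a variable of
        index below \<open>m\<close>.\<close>
      assume "\<not> length us * n + m \<le> t"
      then show False
        using t that by (auto simp: v nth_append len_us split: if_splits)
    qed
  qed
  have "n_variable_word d n v"
    unfolding n_variable_word_def variable_word_def vars
    using letters by (auto simp: occ strict_mono_on_def)
  moreover have "first_occ v ` vars v = block (replicate r n) (length us)"
  proof -
    have "first_occ v ` vars v = (\<lambda>m. length us * n + m) ` {0..<n}"
      unfolding vars using occ by (force simp: lessThan_atLeast0)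
    also have "\<dots> = block (replicate r n) (length us)"
      using s by (simp add: block_def sum_list_replicate take_replicate min_def add.commute)
    finally show ?thesis .
  qed
  moreover have "substitute v a = concat (point w a)" if "a \<in> words d n" for a
  proof -
    let ?h = "\<lambda>l. case l of Const c \<Rightarrow> c | Var m \<Rightarrow> a ! card {i \<in> {..<n}. i < m}"
    \<comment> \<open>The variables are numbered without gaps from 0, so the rank of
      \<open>Var m\<close> is \<open>m\<close>.\<close>
    have "card {i \<in> {..<n}. i < m} = m" if "m < n" for m
    proof -
      have "{i \<in> {..<n}. i < m} = {..<m}" using that by auto
      then show ?thesis by simp
    qed
    then have "map ?h (map Var [0..<n]) = a"
      using that by (intro nth_equalityI) (auto simp: words_def)
    then have "map ?h (case_option (map Var [0..<n]) (map Const) x) = case_option a id x" for x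
      by (cases x) (auto simp: comp_def)
    then show ?thesis
      unfolding substitute_def vars
      by (simp only: v_def expand_def point_def map_concat map_map o_def)
  qed
  ultimately show ?thesis
    unfolding sectionally_homogeneous_def
    using s len_v c
    by (intro exI[of _ "length us"] conjI exI[of _ v] exI[of _ c]) (auto simp: sum_list_replicate)
qed

theorem proposition4p2:
  fixes d k n :: nat
  assumes "0 < d" and "0 < k" and "0 < n"
  shows "\<exists>r. \<not> ENSH d k (replicate r n)"
proof -
  have "words d n = words_over {..<d} n"
    by (simp add: words_def words_over_def)
  then have "finite (words d n)"
    by (simp add: finite_words_over)
  moreover have "replicate n 0 \<in> words d n"
    using assms(1) by (auto simp: words_def)
  ultimately have "hales_jewett (words d n)"
    using hales_jewett by blast
  then obtain r where r: "\<And>f. f ` words_over (words d n) r \<subseteq> {..<k} \<Longrightarrow>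
      has_mono_line (words d n) r f"
    unfolding hales_jewett_def by blast
  have "sectionally_homogeneous d (replicate r n) f"
    if f: "f ` words d (sum_list (replicate r n)) \<subseteq> {..<k}" for f
  \<comment> \<open>Words of \<open>r\<close> letters from \<open>words d n\<close> are coloured
    through \<open>concat\<close>, which sends them into \<open>words d (r * n)\<close>, where
    \<open>f\<close> takes values below \<open>k\<close>.\<close>
  proof (intro sectionally_homogeneous_if_mono_line r)
    have "concat u \<in> words d (r * n)" if u: "u \<in> words_over (words d n) r" for u
      using u length_concat_uniform[of u n] by (fastforce simp: words_over_def words_def)
    then show "(\<lambda>u. f (concat u)) ` words_over (words d n) r \<subseteq> {..<k}"
      using f by (auto simp: sum_list_replicate)
  qed
  then show ?thesis unfolding ENSH_def by blast
qed

end
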